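(* The sets of patterns $\{112,2122\}$ and $\{121,1222\}$ are $m$-equivalent, that is, $\{112,2122\}\sim\{121,1222\}$.
   Context: A (finite, reduced) multiset is $S=1^{a_1}2^{a_2}\cdots k^{a_k}$ with $k\ge 1$ and all $a_i\ge 1$, meaning that $i$ occurs with multiplicity $a_i$. A multipermutation of $S$ is a word having exactly $a_i$ occurrences of each letter $i\in[k]=\{1,\dots,k\}$ and no other letters. A word $\pi=\pi_1\cdots\pi_n$ contains a pattern (word) $\rho=\rho_1\cdots\rho_\ell$ if there are indices $i(1)<\cdots<i(\ell)$ such that for all $a,b\in[\ell]$: $\pi_{i(a)}<\pi_{i(b)}$ iff $\rho_a<\rho_b$, and $\pi_{i(a)}>\pi_{i(b)}$ iff $\rho_a>\rho_b$; otherwise $\pi$ avoids $\rho$. For a set $P$ of patterns, $\mathrm{av}(S;P)$ is the number of multipermutations of $S$ that avoid every pattern in $P$. Two sets of patterns $P,Q$ are $m$-equivalent, written here $P\sim Q$, if $\mathrm{av}(S;P)=\mathrm{av}(S;Q)$ for every multiset $S$. *)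

theory Defs
  imports "HOL-Combinatorics.Multiset_Permutations"
begin

text \<open>
  Words and patterns are lists of natural numbers. List positions are counted from 0,
  so the occurrence indices \<open>i(1) < \<dots> < i(l)\<close> are the values of \<open>i\<close> on \<open>{..<l}\<close>.
\<close>

definition contains :: "nat list \<Rightarrow> nat list \<Rightarrow> bool" where
  "contains w p \<longleftrightarrow>
     (\<exists>i :: nat \<Rightarrow> nat.
        strict_mono_on {..<length p} i \<and>
        i ` {..<length p} \<subseteq> {..<length w} \<and>
        (\<forall>a<length p. \<forall>b<length p.
           (w ! i a < w ! i b \<longleftrightarrow> p ! a < p ! b) \<and>
           (w ! i a > w ! i b \<longleftrightarrow> p ! a > p ! b)))"

definition avoids :: "nat list \<Rightarrow> nat list \<Rightarrow> bool" where
  "avoids w p \<longleftrightarrow> \<not> contains w p"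

text \<open>
  \<open>S = 1^a_1 2^a_2 \<dots> k^a_k\<close> with \<open>k \<ge> 1\<close>; the multiplicity \<open>a_i\<close> is \<open>count S i\<close>, and
  \<open>a_i \<ge> 1\<close> for exactly the letters \<open>i\<close> in \<open>{1..k}\<close>.
\<close>

definition reduced_mset :: "nat multiset \<Rightarrow> bool" where
  "reduced_mset S \<longleftrightarrow> (\<exists>k\<ge>1. set_mset S = {1..k})"

definition av :: "nat multiset \<Rightarrow> nat list set \<Rightarrow> nat" where
  "av S P = card {w \<in> permutations_of_multiset S. \<forall>p\<in>P. avoids w p}"

definition m_equivalent :: "nat list set \<Rightarrow> nat list set \<Rightarrow> bool" where
  "m_equivalent P Q \<longleftrightarrow> (\<forall>S. reduced_mset S \<longrightarrow> av S P = av S Q)"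

end

theory Submission
  imports Defs "HOL-Library.Sublist"
begin

text \<open>
  Build words by inserting the letters in decreasing order. When all \<open>a\<close> copies of a new smallest
  letter \<open>x\<close> are inserted into a word \<open>u v\<close>, avoiding \<open>112\<close> forces the shape \<open>u x v x\<^sup>a\<^sup>-\<^sup>1\<close>, while
  avoiding \<open>121\<close> forces \<open>u x\<^sup>a v\<close>; the length-4 pattern then only restricts where \<open>u\<close> may end.
  Label a word by its number \<open>l\<close> of admissible sites. In both families a word labelled \<open>l\<close> has \<open>l\<close>
  children, all labelled \<open>l + a\<close> if \<open>a \<le> 2\<close>, and labelled \<open>3, \<dots>, l + 2\<close> if \<open>a \<ge> 3\<close>. Hence the two
  generating trees are isomorphic.
\<close>

section \<open>Pattern containment via subsequences\<close>

text \<open>The bound \<open>m\<close> carries the induction: the first \<open>n\<close> indices lie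
  below \<open>f n\<close>, so their letters embed in \<open>take (f n) w\<close>, and the letter at
  \<open>f n\<close> can be appended.\<close>

lemma subseq_map_nth_take:
  assumes "strict_mono_on {..<n} f" "\<And>i. i < n \<Longrightarrow> f i < m" "m \<le> length w"
  shows "subseq (map (\<lambda>i. w ! f i) [0..<n]) (take m w)"
  using assms
proof (induction n arbitrary: m)
  case (Suc n)
  have "subseq (map (\<lambda>i. w ! f i) [0..<n]) (take (f n) w)"
    using Suc.prems by (intro Suc.IH) (auto simp: strict_mono_on_def less_Suc_eq order_less_imp_le
      intro: order_trans[OF order_less_imp_le])
  then have "subseq (map (\<lambda>i. w ! f i) [0..<n] @ [w ! f n]) (take (f n) w @ [w ! f n])"
    by simp
  moreover have "take (f n) w @ [w ! f n] = take (Suc (f n)) w"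
    using Suc.prems(2)[of n] Suc.prems(3) by (simp add: take_Suc_conv_app_nth)
  moreover have "prefix (take (Suc (f n)) w) (take m w)"
    using Suc.prems(2)[of n] take_is_prefix[of "Suc (f n)" "take m w"] by (simp add: Suc_leI)
  ultimately show ?case
    using subseq_order.order_trans by (fastforce dest: prefix_imp_subseq)
qed simp

lemma subseq_imp_index_map:
  assumes "subseq s w"
  shows "\<exists>f. strict_mono_on {..<length s} f \<and> f ` {..<length s} \<subseteq> {..<length w} \<and>
    (\<forall>a<length s. w ! f a = s ! a)"
  using assms
proof (induction rule: list_emb.induct)
  case (list_emb_Cons xs ys y)
  then obtain f where "strict_mono_on {..<length xs} f" "f ` {..<length xs} \<subseteq> {..<length ys}"
    "\<forall>a<length xs. ys ! f a = xs ! a" by blast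
  then show ?case
    by (intro exI[of _ "\<lambda>i. Suc (f i)"]) (auto simp: strict_mono_on_def)
next
  case (list_emb_Cons2 x y xs ys)
  then obtain f where "strict_mono_on {..<length xs} f" "f ` {..<length xs} \<subseteq> {..<length ys}"
    "\<forall>a<length xs. ys ! f a = xs ! a" by blast
  with list_emb_Cons2(1) show ?case
    by (intro exI[of _ "case_nat 0 (\<lambda>i. Suc (f i))"])
      (auto simp: strict_mono_on_def image_subset_iff nth_Cons split: nat.split)
qed auto

text \<open>Order-isomorphic words differ by a strictly increasing relabelling of their letters, so
  an occurrence of \<open>p\<close> is a subsequence of the form \<open>map f p\<close>.\<close>

lemma contains_iff_subseq_map:
  "contains w p \<longleftrightarrow> (\<exists>f. strict_mono_on (set p) f \<and> subseq (map f p) w)" (is "_ \<longleftrightarrow> ?R")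
proof
  assume "contains w p"
  then obtain i where i: "strict_mono_on {..<length p} i" "i ` {..<length p} \<subseteq> {..<length w}"
    and iso: "\<And>a b. a < length p \<Longrightarrow> b < length p \<Longrightarrow> w ! i a < w ! i b \<longleftrightarrow> p ! a < p ! b"
    unfolding contains_def by blast
  \<comment> \<open>A letter \<open>v\<close> of \<open>p\<close> is sent to the letter of
    \<open>w\<close> under one chosen occurrence of \<open>v\<close>. The choice is harmless: equal
    letters of \<open>p\<close> sit on letters of \<open>w\<close> neither of which is smaller than
    the other.\<close>
  define f where "f v = w ! i (SOME a. a < length p \<and> p ! a = v)" for v
  have f: "f (p ! a) = w ! i a" if "a < length p" for a
  proof -
    define b where "b = (SOME b. b < length p \<and> p ! b = p ! a)"
    have "b < length p \<and> p ! b = p ! a" unfolding b_def by (rule someI) (use that in simp)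
    with iso[of a b] iso[of b a] that have "w ! i b = w ! i a" by simp
    then show ?thesis by (simp add: f_def b_def)
  qed
  have "strict_mono_on (set p) f"
    by (rule strict_mono_onI) (use f iso in \<open>auto simp: in_set_conv_nth\<close>)
  moreover have "subseq (map (\<lambda>a. w ! i a) [0..<length p]) (take (length w) w)"
    using i by (intro subseq_map_nth_take) auto
  moreover have "map (\<lambda>a. w ! i a) [0..<length p] = map f p"
    by (rule nth_equalityI) (simp_all add: f)
  ultimately show ?R by auto
next
  assume ?R
  then obtain f where f: "strict_mono_on (set p) f" "subseq (map f p) w" by blast
  from subseq_imp_index_map[OF f(2)] obtain i where
    i: "strict_mono_on {..<length p} i" "i ` {..<length p} \<subseteq> {..<length w}"
    and eq: "\<And>a. a < length p \<Longrightarrow> w ! i a = f (p ! a)" by auto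
  have "f (p ! a) < f (p ! b) \<longleftrightarrow> p ! a < p ! b" if "a < length p" "b < length p" for a b
    using strict_mono_on_less[OF f(1)] that by simp
  with i eq show "contains w p"
    unfolding contains_def by (intro exI[of _ i]) auto
qed

lemma subseq_setD: "subseq s w \<Longrightarrow> x \<in> set s \<Longrightarrow> x \<in> set w"
  by (erule (1) list_emb_set) simp

text \<open>All four patterns use exactly the letters 1 and 2, so a relabelling amounts to a pair
  \<open>y < z\<close>.\<close>

lemma avoids_two_letters:
  assumes "set p = {1, 2}"
  shows "avoids w p \<longleftrightarrow> (\<forall>y z. y < z \<longrightarrow> \<not> subseq (map (\<lambda>i. if i = 1 then y else z) p) w)"
proof -
  have sm: "strict_mono_on {1, 2 :: nat} f \<longleftrightarrow> f 1 < f 2" for f :: "nat \<Rightarrow> nat"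
    by (auto simp: strict_mono_on_def)
  have "contains w p \<longleftrightarrow> (\<exists>f. f 1 < f 2 \<and> subseq (map f p) w)"
    unfolding contains_iff_subseq_map assms sm ..
  also have "\<dots> \<longleftrightarrow> (\<exists>y z. y < z \<and> subseq (map (\<lambda>i. if i = 1 then y else z) p) w)" (is "?L \<longleftrightarrow> ?R")
  proof
    assume ?L
    then obtain f where f: "f 1 < f 2" "subseq (map f p) w" by blast
    have "map f p = map (\<lambda>i. if i = 1 then f 1 else f 2) p"
      using assms by (intro map_cong) auto
    with f show ?R by metis
  next
    assume ?R
    then obtain y z where "y < z \<and> subseq (map (\<lambda>i. if i = 1 then y else z) p) w" by blast
    then show ?L by (intro exI[of _ "\<lambda>i. if i = 1 then y else z"]) simp
  qed
  finally show ?thesis by (auto simp: avoids_def)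
qed

text \<open>An occurrence whose lower letter is not \<open>x\<close> lies entirely above
  \<open>x\<close> and survives the deletion of all copies of \<open>x\<close>; in every other
  occurrence \<open>x\<close> plays the 1. This separates the condition on the parent word from the
  condition on the insertion.\<close>

lemma avoids_min_letter:
  assumes p: "set p = {1, 2}" and x: "\<forall>y\<in>set w. x \<le> y"
  shows "avoids w p \<longleftrightarrow> avoids (filter (\<lambda>y. y \<noteq> x) w) p \<and>
    (\<forall>z>x. \<not> subseq (map (\<lambda>i. if i = 1 then x else z) p) w)"
  unfolding avoids_two_letters[OF p]
proof (intro iffI conjI allI impI notI)
  fix y z
  assume "\<forall>y z. y < z \<longrightarrow> \<not> subseq (map (\<lambda>i. if i = 1 then y else z) p) w" "y < z"
    "subseq (map (\<lambda>i. if i = 1 then y else z) p) (filter (\<lambda>y. y \<noteq> x) w)"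
  then show False using subseq_order.order_trans[OF _ subseq_filter_left] by blast
next
  fix y z
  assume *: "(\<forall>y z. y < z \<longrightarrow> \<not> subseq (map (\<lambda>i. if i = 1 then y else z) p) (filter (\<lambda>y. y \<noteq> x) w)) \<and>
      (\<forall>z>x. \<not> subseq (map (\<lambda>i. if i = 1 then x else z) p) w)"
    and yz: "y < z" and sub: "subseq (map (\<lambda>i. if i = 1 then y else z) p) w" (is "subseq ?s w")
  \<comment> \<open>The pattern contains a 1, so \<open>y\<close> does occur in \<open>w\<close> and
    is bounded below by \<open>x\<close>.\<close>
  have "y \<in> set ?s" using p by (auto simp: image_iff)
  then have "y \<in> set w" by (rule subseq_setD[OF sub])
  moreover have "y \<noteq> x" using * yz sub by blast
  ultimately have "x < y" using x by (simp add: order_less_le)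
  with yz have "filter (\<lambda>y. y \<noteq> x) ?s = ?s" by (auto simp: filter_id_conv)
  with subseq_filter[OF sub, of "\<lambda>y. y \<noteq> x"] * yz show False by simp
qed auto

lemma subseq_replicate_iff: "subseq (replicate n x) w \<longleftrightarrow> n \<le> count_list w x"
proof (induction w arbitrary: n)
  case Nil
  show ?case by (cases n) auto
next
  case (Cons a w)
  from Cons.IH[of n] Cons.IH[of "n - 1"] show ?case by (cases n) auto
qed

lemma count_list_replicate: "count_list (replicate n x) y = (if x = y then n else 0)"
  by (induction n) auto

lemma subseq_append_right_notin:
  assumes "x \<notin> set u"
  shows "subseq (x # s) (u @ v) \<longleftrightarrow> subseq (x # s) v"
  using assms by (induction u) auto

section \<open>Generating trees\<close>

text \<open>Ranks run once through 1 to \<open>card P\<close>: a new maximum takes the last rank and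
  leaves the others unchanged.\<close>

lemma sum_card_atMost:
  fixes P :: "'a::linorder set" and h :: "nat \<Rightarrow> nat"
  assumes "finite P"
  shows "(\<Sum>p\<in>P. h (card {q \<in> P. q \<le> p})) = (\<Sum>j=1..card P. h j)"
  using assms
proof (induction rule: finite_linorder_max_induct)
  case (insert b A)
  have "{q \<in> insert b A. q \<le> b} = insert b A" using insert by auto
  moreover have "{q \<in> insert b A. q \<le> p} = {q \<in> A. q \<le> p}" if "p \<in> A" for p
    using insert that by auto
  moreover have "b \<notin> A" using insert by auto
  ultimately show ?case using insert by simp
qed simp

text \<open>Ranks are counted from the top here, so the induction adds new minima instead.\<close>

lemma sum_card_atLeast:
  fixes P :: "'a::linorder set" and h :: "nat \<Rightarrow> nat"
  assumes "finite P"
  shows "(\<Sum>p\<in>P. h (card {q \<in> P. p \<le> q})) = (\<Sum>j=1..card P. h j)"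
  using assms
proof (induction rule: finite_linorder_min_induct)
  case (insert b A)
  have "{q \<in> insert b A. b \<le> q} = insert b A" using insert by auto
  moreover have "{q \<in> insert b A. p \<le> q} = {q \<in> A. p \<le> q}" if "p \<in> A" for p
    using insert that by auto
  moreover have "b \<notin> A" using insert by auto
  ultimately show ?case using insert by simp
qed simp

text \<open>
  \<open>l\<close> is the label of the parent and \<open>j\<close> the rank of the insertion site among its \<open>l\<close> sites.
\<close>

definition label_child :: "nat \<Rightarrow> nat \<Rightarrow> nat \<Rightarrow> nat" where
  "label_child a l j = (if a \<le> 2 then l + a else j + 2)"

text \<open>\<open>good_iff\<close> says which words are children of \<open>w\<close>, and
  \<open>sum_sites\<close> is the succession rule. The rule is a sum over an arbitrary weight
  \<open>h\<close>, which fixes the multiset of child labels without fixing which site gives which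
  label; the two families rank their sites in opposite directions.\<close>

locale insertion_tree =
  fixes good :: "'a::linorder list \<Rightarrow> bool"
    and sites :: "'a list \<Rightarrow> nat set"
    and ins :: "nat \<Rightarrow> 'a \<Rightarrow> 'a list \<Rightarrow> nat \<Rightarrow> 'a list"
  assumes good_Nil: "good []"
    and sites_Nil: "sites [] = {0}"
    and finite_sites: "finite (sites w)"
    and mset_ins: "a > 0 \<Longrightarrow> mset (ins a x w p) = mset w + replicate_mset a x"
    and filter_ins: "x \<notin> set w \<Longrightarrow> filter (\<lambda>y. y \<noteq> x) (ins a x w p) = w"
    and inj_ins: "a > 0 \<Longrightarrow> x \<notin> set w \<Longrightarrow> inj_on (ins a x w) (sites w)"
    and good_iff: "x \<in> set w' \<Longrightarrow> (\<forall>y\<in>set w'. x \<le> y) \<Longrightarrow> w = filter (\<lambda>y. y \<noteq> x) w' \<Longrightarrow>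
      good w' \<longleftrightarrow> good w \<and> (\<exists>p\<in>sites w. w' = ins (count_list w' x) x w p)"
    and sum_sites: "a > 0 \<Longrightarrow> x \<notin> set w \<Longrightarrow>
      (\<Sum>p\<in>sites w. h (card (sites (ins a x w p)))) =
      (\<Sum>j=1..card (sites w). (h :: nat \<Rightarrow> nat) (label_child a (card (sites w)) j))"
begin

definition words :: "'a multiset \<Rightarrow> 'a list set" where
  "words S = {w \<in> permutations_of_multiset S. good w}"

text \<open>Letting \<open>h\<close> vary records the whole distribution of labels over the words of
  \<open>S\<close>.\<close>

definition label_sum :: "'a multiset \<Rightarrow> (nat \<Rightarrow> nat) \<Rightarrow> nat" where
  "label_sum S h = (\<Sum>w\<in>words S. h (card (sites w)))"

lemma label_sum_empty: "label_sum {#} h = h 1"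
proof -
  have "words {#} = {[]}" by (auto simp: words_def good_Nil)
  then show ?thesis by (simp add: label_sum_def sites_Nil)
qed

text \<open>Good words of the larger multiset correspond bijectively to pairs of a parent and one of
  its sites. Summing over the sites first turns \<open>h\<close> into a new weight on the parent's
  label.\<close>

lemma label_sum_add:
  assumes "a > 0" "\<forall>y\<in>#T. x < y"
  shows "label_sum (T + replicate_mset a x) h =
    label_sum T (\<lambda>l. \<Sum>j=1..l. h (label_child a l j))"
proof -
  have notin: "x \<notin> set w" if "w \<in> words T" for w
    using that assms(2) by (auto simp: words_def permutations_of_multiset_def)
  have count_eq: "count_list (ins a x w p) x = a" if "w \<in> words T" for w p
    using notin[OF that] assms(1)
    by (simp add: mset_ins flip: count_mset)
  let ?\<Sigma> = "Sigma (words T) sites"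
  let ?f = "\<lambda>(w, p). ins a x w p"
  have inj: "inj_on ?f ?\<Sigma>"
  proof (rule inj_onI, clarify)
    fix w p v q
    assume *: "w \<in> words T" "p \<in> sites w" "v \<in> words T" "q \<in> sites v" "ins a x w p = ins a x v q"
    \<comment> \<open>Deleting \<open>x\<close> recovers the parent; injectivity for that parent
      then recovers the site.\<close>
    then have "w = v" using filter_ins notin by metis
    with * show "w = v \<and> p = q" using inj_ins[OF assms(1) notin] by (auto dest: inj_onD)
  qed
  have img: "?f ` ?\<Sigma> = words (T + replicate_mset a x)"
  proof (intro set_eqI iffI)
    fix w' assume "w' \<in> ?f ` ?\<Sigma>"
    then obtain w p where w: "w \<in> words T" "p \<in> sites w" "w' = ins a x w p" by auto
    have m: "mset w' = T + replicate_mset a x"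
      using w assms(1) by (auto simp: mset_ins words_def permutations_of_multiset_def)
    have "set_mset (mset w') = set_mset T \<union> {x}" using m assms(1) by simp
    then have s: "x \<in> set w'" "\<forall>y\<in>set w'. x \<le> y" using assms(2) by auto
    have "good w'"
      using good_iff[OF s, of w] w filter_ins[OF notin] count_eq by (auto simp: words_def)
    then show "w' \<in> words (T + replicate_mset a x)"
      using m by (simp add: words_def permutations_of_multiset_def)
  next
    fix w' assume "w' \<in> words (T + replicate_mset a x)"
    then have m: "mset w' = T + replicate_mset a x" and g: "good w'"
      by (auto simp: words_def permutations_of_multiset_def)
    have "set_mset (mset w') = set_mset T \<union> {x}" using m assms(1) by simp
    then have s: "x \<in> set w'" "\<forall>y\<in>set w'. x \<le> y" using assms(2) by auto
    have "x \<notin># T" using assms(2) by auto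
    then have "count_list w' x = a"
      using m by (simp add: not_in_iff flip: count_mset)
    with good_iff[OF s refl] g obtain p where p: "good (filter (\<lambda>y. y \<noteq> x) w')"
      "p \<in> sites (filter (\<lambda>y. y \<noteq> x) w')" "w' = ins a x (filter (\<lambda>y. y \<noteq> x) w') p" by auto
    have "filter_mset (\<lambda>y. y \<noteq> x) T = T"
      using assms(2) by (intro filter_mset_eq_conv[THEN iffD2]) auto
    then have "mset (filter (\<lambda>y. y \<noteq> x) w') = T"
      by (simp add: m)
    with p(1) have "filter (\<lambda>y. y \<noteq> x) w' \<in> words T"
      by (simp add: words_def permutations_of_multiset_def)
    with p show "w' \<in> ?f ` ?\<Sigma>" by force
  qed
  have "label_sum (T + replicate_mset a x) h = (\<Sum>w'\<in>?f ` ?\<Sigma>. h (card (sites w')))"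
    by (simp add: label_sum_def img)
  also have "\<dots> = (\<Sum>(w, p)\<in>?\<Sigma>. h (card (sites (ins a x w p))))"
    by (subst sum.reindex[OF inj]) (simp add: case_prod_unfold)
  also have "\<dots> = (\<Sum>w\<in>words T. \<Sum>p\<in>sites w. h (card (sites (ins a x w p))))"
    by (subst sum.Sigma) (auto simp: words_def finite_sites)
  also have "\<dots> = label_sum T (\<lambda>l. \<Sum>j=1..l. h (label_child a l j))"
    unfolding label_sum_def by (intro sum.cong refl sum_sites assms(1) notin)
  finally show ?thesis .
qed

end

text \<open>
  The claim must hold for every weight \<open>h\<close>, since \<open>label_sum_add\<close> changes \<open>h\<close>.
\<close>

lemma label_sum_eq:
  assumes "insertion_tree good1 sites1 ins1" "insertion_tree good2 sites2 ins2"
  shows "insertion_tree.label_sum good1 sites1 S h = insertion_tree.label_sum good2 sites2 S h"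
proof -
  interpret A: insertion_tree good1 sites1 ins1 by fact
  interpret B: insertion_tree good2 sites2 ins2 by fact
  show ?thesis
  proof (induction "size S" arbitrary: S h rule: less_induct)
    case less
    show ?case
    proof (cases "S = {#}")
      case True
      then show ?thesis by (simp add: A.label_sum_empty B.label_sum_empty)
    next
      case False
      \<comment> \<open>Removing all copies of the least letter leaves a smaller multiset with
        letters above \<open>x\<close>. Both label sums then unfold to sums over \<open>T\<close>
        with the same new weight.\<close>
      define x where "x = Min (set_mset S)"
      define T where "T = filter_mset (\<lambda>y. y \<noteq> x) S"
      have x: "x \<in># S" using False by (simp add: x_def)
      have T: "\<forall>y\<in>#T. x < y" by (auto simp: T_def x_def order_less_le)
      have S: "S = T + replicate_mset (count S x) x"
        unfolding T_def by (rule multiset_eqI) auto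
      have "count S x > 0" using x by simp
      then have "size T < size S"
        using S by (metis less_add_same_cancel1 size_replicate_mset size_union)
      from less[OF this] show ?thesis
        using A.label_sum_add[OF \<open>count S x > 0\<close> T] B.label_sum_add[OF \<open>count S x > 0\<close> T]
        by (subst (1 2) S) simp
    qed
  qed
qed

section \<open>Inserting a smallest letter\<close>

text \<open>Nothing larger may follow an \<open>x\<close>, so from the first \<open>x\<close> on the
  word is constant.\<close>

lemma filter_neq_append_replicate:
  assumes "\<forall>c\<in>set w. x \<le> c" "\<forall>z>x. \<not> subseq [x, z] w"
  shows "w = filter (\<lambda>c. c \<noteq> x) w @ replicate (count_list w x) (x::'a::linorder)"
  using assms
proof (induction w)
  case (Cons c w)
  show ?case
  proof (cases "c = x")
    case True
    with Cons.prems have "\<forall>z\<in>set w. z = x"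
      by (auto simp: subseq_singleton_left order_less_le)
    then have "w = replicate (length w) x" by (simp add: replicate_eqI)
    then obtain n where "w = replicate n x" by blast
    then show ?thesis using True by (simp add: count_list_replicate filter_replicate)
  next
    case False
    then show ?thesis using Cons by auto
  qed
qed simp

lemma replicate_append_filter_neq:
  assumes "\<forall>c\<in>set w. x \<le> c" "\<forall>z>x. \<not> subseq [z, x] w"
  shows "w = replicate (count_list w x) x @ filter (\<lambda>c. c \<noteq> x) (w::'a::linorder list)"
  using assms
proof (induction w)
  case (Cons c w)
  show ?case
  proof (cases "c = x")
    case True
    have "\<forall>z>x. \<not> subseq [z, x] w" using Cons.prems(2) by blast
    with Cons True show ?thesis by auto
  next
    case False
    with Cons.prems have "x \<notin> set w"
      by (auto simp: subseq_singleton_left order_less_le)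
    then have "filter (\<lambda>c. c \<noteq> x) w = w" by (auto simp: filter_id_conv)
    with False \<open>x \<notin> set w\<close> show ?thesis by simp
  qed
qed simp

section \<open>Admissible sites and the shape of the insertions\<close>

text \<open>A site is a gap, numbered by the letters to its left. An \<open>x\<close> placed there
  completes 2122 exactly when some letter on the left occurs twice on the right.\<close>

definition sites_112 :: "nat list \<Rightarrow> nat set" where
  "sites_112 w = {p. p \<le> length w \<and> (\<forall>i\<in>set (take p w). count_list (drop p w) i \<le> 1)}"

definition ins_112 :: "nat \<Rightarrow> nat \<Rightarrow> nat list \<Rightarrow> nat \<Rightarrow> nat list" where
  "ins_112 a x w p = take p w @ x # drop p w @ replicate (a - 1) x"

text \<open>An \<open>x\<close> in the gap completes 1222 exactly when some letter occurs three
  times to its right.\<close>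

definition sites_121 :: "nat list \<Rightarrow> nat set" where
  "sites_121 w = {p. p \<le> length w \<and> (\<forall>i. count_list (drop p w) i \<le> 2)}"

definition ins_121 :: "nat \<Rightarrow> nat \<Rightarrow> nat list \<Rightarrow> nat \<Rightarrow> nat list" where
  "ins_121 a x w p = take p w @ replicate a x @ drop p w"

text \<open>The first \<open>x\<close> determines the site. Avoiding 112 pushes all later copies to
  the end, and avoiding 2122 across the first \<open>x\<close> is the site condition.\<close>

lemma ins_112_characterization:
  assumes x: "x \<in> set w'" "\<forall>y\<in>set w'. x \<le> y" and w: "w = filter (\<lambda>y. y \<noteq> x) w'"
  shows "(\<forall>z>x. \<not> subseq [x, x, z] w' \<and> \<not> subseq [z, x, z, z] w') \<longleftrightarrow>
    (\<exists>p\<in>sites_112 w. w' = ins_112 (count_list w' x) x w p)"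
proof
  assume av: "\<forall>z>x. \<not> subseq [x, x, z] w' \<and> \<not> subseq [z, x, z, z] w'"
  obtain u v where uv: "w' = u @ x # v" "x \<notin> set u" using split_list_first[OF x(1)] by blast
  have "\<not> subseq [x, z] v" if "z > x" for z
    using av that uv by (auto simp: subseq_append_right_notin)
  then have v: "v = filter (\<lambda>y. y \<noteq> x) v @ replicate (count_list v x) x"
    using x(2) uv by (intro filter_neq_append_replicate) auto
  have w_eq: "w = u @ filter (\<lambda>y. y \<noteq> x) v" using w uv by (auto simp: filter_id_conv)
  have "count_list (filter (\<lambda>y. y \<noteq> x) v) i \<le> 1" if "i \<in> set u" for i
  proof (rule ccontr)
    assume "\<not> ?thesis"
    then have "subseq (replicate 2 i) (filter (\<lambda>y. y \<noteq> x) v)" by (simp add: subseq_replicate_iff)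
    then have "subseq (replicate 2 i) v" using subseq_order.order_trans[OF _ subseq_filter_left] by blast
    moreover have "subseq [i] u" using that by (simp add: subseq_singleton_left)
    ultimately have "subseq ([i] @ [x] @ replicate 2 i) (u @ [x] @ v)"
      by (intro list_emb_append_mono) auto
    moreover have "i > x" using that uv x(2) by (auto simp: order_less_le)
    ultimately show False using av uv by (simp add: numeral_2_eq_2)
  qed
  then have "length u \<in> sites_112 w" by (simp add: sites_112_def w_eq)
  moreover have "w' = ins_112 (count_list w' x) x w (length u)"
    using uv v by (simp add: ins_112_def w_eq count_list_0_iff)
  ultimately show "\<exists>p\<in>sites_112 w. w' = ins_112 (count_list w' x) x w p" by blast
next
  assume "\<exists>p\<in>sites_112 w. w' = ins_112 (count_list w' x) x w p"
  then obtain p where p: "p \<in> sites_112 w" "w' = ins_112 (count_list w' x) x w p" by blast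
  define u v n where "u = take p w" and "v = drop p w" and "n = count_list w' x - 1"
  have w': "w' = u @ x # v @ replicate n x" using p(2) by (simp add: ins_112_def u_def v_def n_def)
  have "x \<notin> set w" using w by simp
  then have notin: "x \<notin> set u" "x \<notin> set v" by (auto simp: u_def v_def dest: in_set_takeD in_set_dropD)
  have site: "\<forall>i\<in>set u. count_list v i \<le> 1" using p(1) by (simp add: sites_112_def u_def v_def)
  have tail: "\<not> subseq (x # z # s) (v @ replicate n x)" if "z > x" for z s
  proof
    assume "subseq (x # z # s) (v @ replicate n x)"
    then have "subseq (x # z # s) (replicate n x)" by (simp add: subseq_append_right_notin notin)
    then have "z \<in> set (replicate n x)" by (rule subseq_setD) simp
    then show False using that by (simp split: if_splits)
  qed
  show "\<forall>z>x. \<not> subseq [x, x, z] w' \<and> \<not> subseq [z, x, z, z] w'"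
  proof (intro allI impI conjI)
    fix z assume z: "x < z"
    show "\<not> subseq [x, x, z] w'" using tail[OF z] notin by (simp add: w' subseq_append_right_notin)
    show "\<not> subseq [z, x, z, z] w'"
    proof
      assume sub: "subseq [z, x, z, z] w'"
      show False
      \<comment> \<open>If \<open>z\<close> is in \<open>u\<close>, two copies of \<open>z\<close>
        lie in \<open>v\<close>, against the site condition. Otherwise even the first
        \<open>z\<close> comes after the inserted \<open>x\<close>, so the pattern's 1 is a trailing
        copy, which nothing larger follows.\<close>
      proof (cases "z \<in> set u")
        case True
        have "subseq [x, z, z] (u @ x # v @ replicate n x)"
          using subseq_Cons'[OF sub] by (simp add: w')
        then have "subseq [z, z] (v @ replicate n x)" by (simp add: subseq_append_right_notin notin)
        then have "subseq (replicate 2 z) (v @ replicate n x)" by (simp add: numeral_2_eq_2)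
        then have "2 \<le> count_list v z"
          using z by (simp add: subseq_replicate_iff count_list_replicate split: if_splits)
        then show False using site True by force
      next
        case False
        then have "subseq [z, x, z, z] (v @ replicate n x)"
          using sub z by (simp add: w' subseq_append_right_notin)
        then show False using tail[OF z] by (blast dest: subseq_Cons')
      qed
    qed
  qed
qed

text \<open>Avoiding 121 makes the copies of \<open>x\<close> one block, and avoiding 1222 bounds
  every multiplicity after it by 2.\<close>

lemma ins_121_characterization:
  assumes x: "x \<in> set w'" "\<forall>y\<in>set w'. x \<le> y" and w: "w = filter (\<lambda>y. y \<noteq> x) w'"
  shows "(\<forall>z>x. \<not> subseq [x, z, x] w' \<and> \<not> subseq [x, z, z, z] w') \<longleftrightarrow>
    (\<exists>p\<in>sites_121 w. w' = ins_121 (count_list w' x) x w p)"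
proof
  assume av: "\<forall>z>x. \<not> subseq [x, z, x] w' \<and> \<not> subseq [x, z, z, z] w'"
  obtain u v where uv: "w' = u @ x # v" "x \<notin> set u" using split_list_first[OF x(1)] by blast
  have "\<not> subseq [z, x] v" if "z > x" for z
    using av that uv by (auto simp: subseq_append_right_notin)
  then have v: "v = replicate (count_list v x) x @ filter (\<lambda>y. y \<noteq> x) v"
    using x(2) uv by (intro replicate_append_filter_neq) auto
  have w_eq: "w = u @ filter (\<lambda>y. y \<noteq> x) v" using w uv by (auto simp: filter_id_conv)
  have "count_list (filter (\<lambda>y. y \<noteq> x) v) i \<le> 2" for i
  proof (rule ccontr)
    assume "\<not> ?thesis"
    then have 3: "subseq (replicate 3 i) (filter (\<lambda>y. y \<noteq> x) v)" by (simp add: subseq_replicate_iff)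
    then have "i \<in> set (filter (\<lambda>y. y \<noteq> x) v)"
      by (rule subseq_setD) simp
    then have "i > x" using uv x(2) by (auto simp: order_less_le)
    moreover have "subseq (replicate 3 i) v"
      using 3 subseq_order.order_trans[OF _ subseq_filter_left] by blast
    ultimately show False
      using av uv by (auto simp: numeral_3_eq_3 subseq_append_right_notin)
  qed
  then have "length u \<in> sites_121 w" by (simp add: sites_121_def w_eq)
  moreover have "w' = ins_121 (count_list w' x) x w (length u)"
    using uv v by (simp add: ins_121_def w_eq count_list_0_iff)
  ultimately show "\<exists>p\<in>sites_121 w. w' = ins_121 (count_list w' x) x w p" by blast
next
  assume "\<exists>p\<in>sites_121 w. w' = ins_121 (count_list w' x) x w p"
  then obtain p where p: "p \<in> sites_121 w" "w' = ins_121 (count_list w' x) x w p" by blast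
  define u v n where "u = take p w" and "v = drop p w" and "n = count_list w' x"
  have w': "w' = u @ replicate n x @ v" using p(2) by (simp add: ins_121_def u_def v_def n_def)
  have "x \<notin> set w" using w by simp
  then have notin: "x \<notin> set u" "x \<notin> set v" by (auto simp: u_def v_def dest: in_set_takeD in_set_dropD)
  have site: "count_list v i \<le> 2" for i using p(1) by (simp add: sites_121_def v_def)
  \<comment> \<open>The block holds only copies of \<open>x\<close>, so larger letters after an
    \<open>x\<close> must come from \<open>v\<close>.\<close>
  have tail: "subseq (z # s) v" if "z > x" "subseq (x # z # s) w'" for z s
  proof -
    have "subseq (x # z # s) (replicate n x @ v)"
      using that(2) notin by (simp add: w' subseq_append_right_notin)
    then have "subseq (z # s) (replicate n x @ v)" by (rule subseq_Cons')
    then show ?thesis using that(1) by (subst (asm) subseq_append_right_notin) auto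
  qed
  show "\<forall>z>x. \<not> subseq [x, z, x] w' \<and> \<not> subseq [x, z, z, z] w'"
  proof (intro allI impI conjI notI)
    fix z assume z: "x < z" "subseq [x, z, x] w'"
    have "x \<in> set v" using subseq_setD[OF tail[OF z], of x] by auto
    then show False using notin by simp
  next
    fix z assume z: "x < z" "subseq [x, z, z, z] w'"
    have "subseq (replicate 3 z) v" using tail[OF z] by (simp add: numeral_3_eq_3)
    then show False using site[of z] by (simp add: subseq_replicate_iff)
  qed
qed

section \<open>Labels of the children\<close>

lemma card_split_at:
  fixes P :: "nat set"
  assumes "finite P" "p \<in> P"
  shows "card {q \<in> P. q \<le> p} + card {q \<in> P. p \<le> q} = card P + 1"
    and "card {q \<in> P. q < p} + card {q \<in> P. p \<le> q} = card P"
proof -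
  have "{q \<in> P. q \<le> p} \<union> {q \<in> P. p \<le> q} = P" "{q \<in> P. q \<le> p} \<inter> {q \<in> P. p \<le> q} = {p}"
    using assms by auto
  with card_Un_Int[of "{q \<in> P. q \<le> p}" "{q \<in> P. p \<le> q}"] assms
  show "card {q \<in> P. q \<le> p} + card {q \<in> P. p \<le> q} = card P + 1" by simp
  have "{q \<in> P. q < p} \<union> {q \<in> P. p \<le> q} = P" "{q \<in> P. q < p} \<inter> {q \<in> P. p \<le> q} = {}"
    by auto
  with card_Un_Int[of "{q \<in> P. q < p}" "{q \<in> P. p \<le> q}"] assms
  show "card {q \<in> P. q < p} + card {q \<in> P. p \<le> q} = card P" by simp
qed

lemma finite_sites_112: "finite (sites_112 w)" and finite_sites_121: "finite (sites_121 w)"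
  by (rule finite_subset[of _ "{..length w}"]; auto simp: sites_112_def sites_121_def)+

text \<open>Gaps left of the first \<open>x\<close> keep their status. Any gap to its right has
  \<open>x\<close> in its prefix, so at most one trailing \<open>x\<close> may lie beyond it. For
  \<open>a \<ge> 3\<close> this kills all old sites after the first \<open>x\<close> and leaves the
  last two gaps of the word.\<close>

lemma card_sites_ins_112:
  assumes "a > 0" "x \<notin> set w" "p \<in> sites_112 w"
  shows "card (sites_112 (ins_112 a x w p)) =
    label_child a (card (sites_112 w)) (card {q \<in> sites_112 w. q \<le> p})"
proof -
  define u v where "u = take p w" and "v = drop p w"
  have w: "w = u @ v" by (simp add: u_def v_def)
  have p: "p = length u" using assms(3) by (simp add: u_def sites_112_def)
  have notin: "x \<notin> set u" "x \<notin> set v" using assms(2) w by auto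
  let ?w' = "u @ x # v @ replicate (a - 1) x"
  have ins: "ins_112 a x w p = ?w'" by (simp add: ins_112_def u_def v_def)
  have before: "q \<in> sites_112 ?w' \<longleftrightarrow> q \<in> sites_112 w" if "q \<le> length u" for q
    using that notin by (auto simp: sites_112_def w count_list_replicate dest: in_set_takeD)
  have between: "Suc q \<in> sites_112 ?w' \<longleftrightarrow> q \<in> sites_112 w \<and> a \<le> 2"
    if "length u \<le> q" "q \<le> length w" for q
  proof -
    define r where "r = q - length u"
    have r: "q = length u + r" "r \<le> length v" using that w by (simp_all add: r_def)
    have "x \<notin> set (take r v)" "x \<notin> set (drop r v)" using notin by (auto dest: in_set_takeD in_set_dropD)
    then show ?thesis using notin r assms(1)
      by (auto simp: sites_112_def w count_list_replicate count_list_0_iff)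
  qed
  have after: "length w + 1 + s \<in> sites_112 ?w' \<longleftrightarrow> a \<le> s + 2" if "1 \<le> s" "s \<le> a - 1" for s
    using that by (auto simp: sites_112_def w count_list_replicate)
  have bound: "q \<le> length w + a" if "q \<in> sites_112 ?w'" for q
    using that assms(1) by (simp add: sites_112_def w)
  \<comment> \<open>\<open>?B\<close> holds the sites from just after the first \<open>x\<close> to
    the end of \<open>v\<close>, \<open>?C\<close> those past at least one trailing
    \<open>x\<close>. The lower bound 1 leaves the end of \<open>v\<close> to \<open>?B\<close>;
    \<open>a - 2\<close> leaves at most one \<open>x\<close> to the right.\<close>
  let ?A = "{q \<in> sites_112 w. q \<le> p}" and ?B = "Suc ` {q \<in> sites_112 w. p \<le> q \<and> a \<le> 2}"
    and ?C = "(\<lambda>s. length w + 1 + s) ` {max 1 (a - 2)..a - 1}"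
  have sites_le: "q \<le> length w" if "q \<in> sites_112 w" for q using that by (simp add: sites_112_def)
  have "sites_112 ?w' = ?A \<union> ?B \<union> ?C"
  proof (intro set_eqI)
    fix q
    consider "q \<le> p" | q' where "q = Suc q'" "p \<le> q'" "q' \<le> length w"
      | s where "q = length w + 1 + s" "1 \<le> s"
    proof (cases "q \<le> p")
      case False
      show thesis
      proof (cases "q \<le> length w + 1")
        case True
        then show thesis using False that(2)[of "q - 1"] by auto
      next
        case 2: False
        then show thesis using that(3)[of "q - (length w + 1)"] by auto
      qed
    qed (use that in auto)
    then show "q \<in> sites_112 ?w' \<longleftrightarrow> q \<in> ?A \<union> ?B \<union> ?C"
    proof cases
      case 1
      then show ?thesis using before[of q] p sites_le w by auto
    next
      case 2
      then show ?thesis using between[of q'] p by auto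
    next
      case 3
      show ?thesis
      proof (cases "s \<le> a - 1")
        case True
        then show ?thesis using 3 after[of s] p w sites_le by (fastforce simp: image_iff)
      next
        case False
        then show ?thesis using 3 bound[of q] p w sites_le by fastforce
      qed
    qed
  qed
  moreover have "finite ?A" "finite ?B" using finite_sites_112 by auto
  moreover have "?A \<inter> ?B = {}" "(?A \<union> ?B) \<inter> ?C = {}" using sites_le by fastforce+
  ultimately have "card (sites_112 ?w') = card ?A + card ?B + card ?C"
    by (simp add: card_Un_disjoint)
  also have "card ?B = (if a \<le> 2 then card {q \<in> sites_112 w. p \<le> q} else 0)"
    by (simp add: card_image)
  also have "card ?C = (if a \<le> 2 then a - 1 else 2)"
    using assms(1) by (subst card_image) (auto simp: inj_on_def)
  \<comment> \<open>For \<open>a \<le> 2\<close> the first \<open>x\<close> splits the site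
    \<open>p\<close> in two, so the total is the old label plus 1 plus \<open>a - 1\<close>.\<close>
  finally show ?thesis
    using card_split_at(1)[OF finite_sites_112 assms(3)] assms(1) by (auto simp: ins label_child_def)
qed

text \<open>A gap left of the block has all \<open>a\<close> copies of \<open>x\<close> to its
  right, so it survives only for \<open>a \<le> 2\<close>; gaps right of the block are merely
  shifted. Surviving sites are therefore ranked from the right.\<close>

lemma card_sites_ins_121:
  assumes "a > 0" "x \<notin> set w" "p \<in> sites_121 w"
  shows "card (sites_121 (ins_121 a x w p)) =
    label_child a (card (sites_121 w)) (card {q \<in> sites_121 w. p \<le> q})"
proof -
  define u v where "u = take p w" and "v = drop p w"
  have w: "w = u @ v" by (simp add: u_def v_def)
  have p: "p = length u" using assms(3) by (simp add: u_def sites_121_def)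
  have notin: "x \<notin> set u" "x \<notin> set v" using assms(2) w by auto
  have v: "count_list v i \<le> 2" for i using assms(3) by (simp add: sites_121_def v_def)
  let ?w' = "u @ replicate a x @ v"
  have ins: "ins_121 a x w p = ?w'" by (simp add: ins_121_def u_def v_def)
  have before: "q \<in> sites_121 ?w' \<longleftrightarrow> q \<in> sites_121 w \<and> a \<le> 2" if "q \<le> length u" for q
  proof -
    have "x \<notin> set (drop q u)" using notin by (auto dest: in_set_dropD)
    then have "count_list (drop q ?w') i = (if i = x then a else count_list (drop q w) i)" for i
      using that notin by (simp add: w count_list_replicate count_list_0_iff)
    moreover have "count_list (drop q w) x = 0"
      using assms(2) by (auto simp: count_list_0_iff dest: in_set_dropD)
    ultimately show ?thesis using that by (auto simp: sites_121_def w split: if_splits)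
  qed
  have inside: "length u + s \<in> sites_121 ?w' \<longleftrightarrow> a \<le> s + 2" if "s \<le> a" for s
  proof -
    have "count_list (drop (length u + s) ?w') i = (if i = x then a - s else count_list v i)" for i
      using that notin by (simp add: count_list_replicate count_list_0_iff)
    then show ?thesis using that v by (auto simp: sites_121_def split: if_splits)
  qed
  have after: "q + a \<in> sites_121 ?w' \<longleftrightarrow> q \<in> sites_121 w" if "length u \<le> q" for q
    using that by (auto simp: sites_121_def w)
  \<comment> \<open>\<open>?B\<close> holds the gaps of the block with one or two copies of
    \<open>x\<close> to the right; truncated subtraction makes this the whole block for
    \<open>a \<le> 2\<close>. Its left end belongs to \<open>?B\<close>, hence \<open>q < p\<close>
    in \<open>?A\<close>; its right end is \<open>p\<close> shifted into \<open>?C\<close>.\<close>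
  let ?A = "{q \<in> sites_121 w. q < p \<and> a \<le> 2}" and ?B = "(\<lambda>s. p + s) ` {a - 2..<a}"
    and ?C = "(\<lambda>q. q + a) ` {q \<in> sites_121 w. p \<le> q}"
  have "sites_121 ?w' = ?A \<union> ?B \<union> ?C"
  proof (intro set_eqI)
    fix q
    consider "q < p" | s where "q = p + s" "s < a" | q' where "q = q' + a" "p \<le> q'"
    proof (cases "q < p")
      case False
      show thesis
      proof (cases "q < p + a")
        case True
        then show thesis using False that(2)[of "q - p"] by auto
      next
        case 2: False
        then show thesis using that(3)[of "q - a"] by auto
      qed
    qed (use that in auto)
    then show "q \<in> sites_121 ?w' \<longleftrightarrow> q \<in> ?A \<union> ?B \<union> ?C"
    proof cases
      case 1
      then show ?thesis using before[of q] p by auto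
    next
      case 2
      then show ?thesis using inside[of s] p by auto
    next
      case 3
      then show ?thesis using after[of q'] p by auto
    qed
  qed
  moreover have "finite ?A" "finite ?C" using finite_sites_121 by auto
  moreover have "?A \<inter> ?B = {}" "(?A \<union> ?B) \<inter> ?C = {}" by auto
  ultimately have "card (sites_121 ?w') = card ?A + card ?B + card ?C"
    by (simp add: card_Un_disjoint)
  also have "card ?A = (if a \<le> 2 then card {q \<in> sites_121 w. q < p} else 0)"
    by simp
  also have "card ?B = (if a \<le> 2 then a else 2)"
    by (subst card_image) (auto simp: inj_on_def)
  also have "card ?C = card {q \<in> sites_121 w. p \<le> q}"
    by (subst card_image) (auto simp: inj_on_def)
  finally show ?thesis
    using card_split_at(2)[OF finite_sites_121 assms(3)] by (auto simp: ins label_child_def)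
qed

section \<open>The two families as insertion trees\<close>

lemma mset_take_drop: "mset (take p w) + mset (drop p w) = mset w"
  by (simp flip: mset_append)

lemma insertion_tree_112:
  "insertion_tree (\<lambda>w. \<forall>p\<in>{[1,1,2], [2,1,2,2]}. avoids w p) sites_112 ins_112"
proof
  show "\<forall>p\<in>{[1,1,2], [2,1,2,2]}. avoids [] p"
    by (simp add: avoids_def contains_iff_subseq_map)
  show "sites_112 [] = {0}" by (auto simp: sites_112_def)
  show "finite (sites_112 w)" for w by (rule finite_sites_112)
next
  fix a x p :: nat and w
  assume "a > 0"
  then have "replicate_mset a x = add_mset x (replicate_mset (a - 1) x)"
    by (metis Suc_pred' replicate_mset_Suc)
  then show "mset (ins_112 a x w p) = mset w + replicate_mset a x"
    by (simp add: ins_112_def mset_take_drop)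
next
  fix a x p :: nat and w
  assume "x \<notin> set w"
  then have "filter (\<lambda>y. y \<noteq> x) (take p w) @ filter (\<lambda>y. y \<noteq> x) (drop p w) = w"
    by (auto simp: filter_id_conv simp flip: filter_append)
  then show "filter (\<lambda>y. y \<noteq> x) (ins_112 a x w p) = w"
    by (simp add: ins_112_def filter_replicate)
next
  fix a x :: nat and w
  assume x: "x \<notin> set w"
  \<comment> \<open>The site is read off as the number of letters before the first
    \<open>x\<close>.\<close>
  have "length (takeWhile (\<lambda>y. y \<noteq> x) (ins_112 a x w p)) = p" if "p \<in> sites_112 w" for p
  proof -
    have "takeWhile (\<lambda>y. y \<noteq> x) (ins_112 a x w p) = take p w"
      unfolding ins_112_def using x by (subst takeWhile_append2) (auto dest: in_set_takeD)
    then show ?thesis using that by (simp add: sites_112_def)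
  qed
  then show "inj_on (ins_112 a x w) (sites_112 w)" by (metis inj_onI)
next
  fix x :: nat and w w'
  assume *: "x \<in> set w'" "\<forall>y\<in>set w'. x \<le> y" "w = filter (\<lambda>y. y \<noteq> x) w'"
  have "(\<forall>p\<in>{[1,1,2], [2,1,2,2]}. avoids w' p) \<longleftrightarrow>
      (\<forall>p\<in>{[1,1,2], [2,1,2,2]}. avoids w p) \<and>
      (\<forall>z>x. \<not> subseq [x, x, z] w' \<and> \<not> subseq [z, x, z, z] w')"
    using avoids_min_letter[OF _ *(2), of "[1,1,2]"] avoids_min_letter[OF _ *(2), of "[2,1,2,2]"] *(3)
    by (auto simp: insert_commute)
  then show "(\<forall>p\<in>{[1,1,2], [2,1,2,2]}. avoids w' p) \<longleftrightarrow>
      (\<forall>p\<in>{[1,1,2], [2,1,2,2]}. avoids w p) \<and>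
      (\<exists>p\<in>sites_112 w. w' = ins_112 (count_list w' x) x w p)"
    unfolding ins_112_characterization[OF *] .
next
  fix a x :: nat and w and h :: "nat \<Rightarrow> nat"
  assume "a > 0" "x \<notin> set w"
  then show "(\<Sum>p\<in>sites_112 w. h (card (sites_112 (ins_112 a x w p)))) =
      (\<Sum>j=1..card (sites_112 w). h (label_child a (card (sites_112 w)) j))"
    \<comment> \<open>Sites are ranked from the left here.\<close>
    using sum_card_atMost[OF finite_sites_112, of "\<lambda>j. h (label_child a (card (sites_112 w)) j)" w]
    by (simp add: card_sites_ins_112)
qed

lemma insertion_tree_121:
  "insertion_tree (\<lambda>w. \<forall>p\<in>{[1,2,1], [1,2,2,2]}. avoids w p) sites_121 ins_121"
proof
  show "\<forall>p\<in>{[1,2,1], [1,2,2,2]}. avoids [] p"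
    by (simp add: avoids_def contains_iff_subseq_map)
  show "sites_121 [] = {0}" by (auto simp: sites_121_def)
  show "finite (sites_121 w)" for w by (rule finite_sites_121)
next
  fix a x p :: nat and w
  show "mset (ins_121 a x w p) = mset w + replicate_mset a x"
    by (simp add: ins_121_def mset_take_drop)
next
  fix a x p :: nat and w
  assume "x \<notin> set w"
  then have "filter (\<lambda>y. y \<noteq> x) (take p w) @ filter (\<lambda>y. y \<noteq> x) (drop p w) = w"
    by (auto simp: filter_id_conv simp flip: filter_append)
  then show "filter (\<lambda>y. y \<noteq> x) (ins_121 a x w p) = w"
    by (simp add: ins_121_def filter_replicate)
next
  fix a x :: nat and w
  assume a: "a > 0" and x: "x \<notin> set w"
  have "length (takeWhile (\<lambda>y. y \<noteq> x) (ins_121 a x w p)) = p" if "p \<in> sites_121 w" for p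
  proof -
    have "takeWhile (\<lambda>y. y \<noteq> x) (ins_121 a x w p) = take p w"
      unfolding ins_121_def using x a
      by (subst takeWhile_append2) (auto dest: in_set_takeD simp: gr0_conv_Suc)
    then show ?thesis using that by (simp add: sites_121_def)
  qed
  then show "inj_on (ins_121 a x w) (sites_121 w)" by (metis inj_onI)
next
  fix x :: nat and w w'
  assume *: "x \<in> set w'" "\<forall>y\<in>set w'. x \<le> y" "w = filter (\<lambda>y. y \<noteq> x) w'"
  have "(\<forall>p\<in>{[1,2,1], [1,2,2,2]}. avoids w' p) \<longleftrightarrow>
      (\<forall>p\<in>{[1,2,1], [1,2,2,2]}. avoids w p) \<and>
      (\<forall>z>x. \<not> subseq [x, z, x] w' \<and> \<not> subseq [x, z, z, z] w')"
    using avoids_min_letter[OF _ *(2), of "[1,2,1]"] avoids_min_letter[OF _ *(2), of "[1,2,2,2]"] *(3)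
    by (auto simp: insert_commute)
  then show "(\<forall>p\<in>{[1,2,1], [1,2,2,2]}. avoids w' p) \<longleftrightarrow>
      (\<forall>p\<in>{[1,2,1], [1,2,2,2]}. avoids w p) \<and>
      (\<exists>p\<in>sites_121 w. w' = ins_121 (count_list w' x) x w p)"
    unfolding ins_121_characterization[OF *] .
next
  fix a x :: nat and w and h :: "nat \<Rightarrow> nat"
  assume "a > 0" "x \<notin> set w"
  then show "(\<Sum>p\<in>sites_121 w. h (card (sites_121 (ins_121 a x w p)))) =
      (\<Sum>j=1..card (sites_121 w). h (label_child a (card (sites_121 w)) j))"
    using sum_card_atLeast[OF finite_sites_121, of "\<lambda>j. h (label_child a (card (sites_121 w)) j)" w]
    by (simp add: card_sites_ins_121)
qed

text \<open>The constant weight 1 turns the label sum into a count of words.\<close>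

lemma av_eq_label_sum:
  assumes "insertion_tree (\<lambda>w. \<forall>p\<in>P. avoids w p) sites ins"
  shows "av S P = insertion_tree.label_sum (\<lambda>w. \<forall>p\<in>P. avoids w p) sites S (\<lambda>_. 1)"
  unfolding insertion_tree.label_sum_def[OF assms] insertion_tree.words_def[OF assms]
  by (simp add: av_def)

theorem theorem2p12:
  shows "m_equivalent {[1,1,2], [2,1,2,2]} {[1,2,1], [1,2,2,2]}"
  unfolding m_equivalent_def av_eq_label_sum[OF insertion_tree_112]
    av_eq_label_sum[OF insertion_tree_121]
  using label_sum_eq[OF insertion_tree_112 insertion_tree_121] by blast

end
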